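(* Let $d \ge 1$ and let $f : \mathbb{R}^d \to \mathbb{R}$ be a continuously differentiable function. Then $f$ preserves the unordered weak majorization partial order $\precsim$ on $\mathbb{R}^d$ (that is, $u \precsim v$ implies $f(u) \le f(v)$ for all $u, v \in \mathbb{R}^d$) if and only if for any $z \in \mathbb{R}^d$, $$f_{(1)}(z) \ge f_{(2)}(z) \ge \dots \ge f_{(d)}(z) \ge 0,$$ where $f_{(i)}$ denotes the partial derivative of $f$ with respect to the $i$-th coordinate.
   Context: The unordered weak majorization partial order $\precsim$ on $\mathbb{R}^d$ is defined by: $(u_1,\dots,u_d) \precsim (v_1,\dots,v_d)$ if and only if $\sum_{k=1}^i u_k \le \sum_{k=1}^i v_k$ for all $i = 1,2,\dots,d$. *)

theory Defs
  imports "HOL-Analysis.Analysis"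
begin

text \<open>
  \<open>\<real>\<^sup>d\<close> with coordinates \<open>1, \<dots>, d\<close> is \<open>real ^ 'n\<close> for an index type \<open>'n\<close> that is finite and
  linearly ordered. Such a type is nonempty and order isomorphic to \<open>{1..d}\<close> with
  \<open>d = CARD('n) \<ge> 1\<close>, and every \<open>d \<ge> 1\<close> arises (for instance from the numeral types).
  The linear order on the indices is what fixes the numbering of the coordinates.
\<close>

definition weak_majorized ::
    "real ^ 'n::{finite,linorder} \<Rightarrow> real ^ 'n::{finite,linorder} \<Rightarrow> bool"  (infix \<open>\<precsim>\<close> 50)
  where "u \<precsim> v \<longleftrightarrow> (\<forall>i. (\<Sum>k\<in>{..i}. u $ k) \<le> (\<Sum>k\<in>{..i}. v $ k))"

text \<open>
  Continuity of the derivative is with respect to the operator norm on \<open>\<Rightarrow>\<^sub>L\<close>.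
\<close>

definition continuously_differentiable :: "(real ^ 'n \<Rightarrow> real) \<Rightarrow> bool"
  where "continuously_differentiable f \<longleftrightarrow>
    (\<exists>f' :: real ^ 'n \<Rightarrow> ((real ^ 'n) \<Rightarrow>\<^sub>L real).
       (\<forall>x. (f has_derivative blinfun_apply (f' x)) (at x)) \<and> continuous_on UNIV f')"

definition partial_deriv :: "'n \<Rightarrow> (real ^ 'n \<Rightarrow> real) \<Rightarrow> real ^ 'n \<Rightarrow> real"
  where "partial_deriv i f z = deriv (\<lambda>t. f (z + t *\<^sub>R axis i 1)) 0"

end

theory Submission imports Defs begin

text \<open>
  Monotonicity of \<open>f\<close> for \<open>\<precsim>\<close> means that every directional derivative of \<open>f\<close> along a vector
  \<open>w\<close> with \<open>0 \<precsim> w\<close> is nonnegative (difference quotients one way, the mean value theorem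
  the other way). Such \<open>w\<close> include the unit vectors \<open>e\<^sub>i\<close> and the differences \<open>e\<^sub>i - e\<^sub>j\<close> for
  \<open>i \<le> j\<close>, which generate the cone \<open>{w. 0 \<precsim> w}\<close>; the generation is expressed by
  summation by parts.
\<close>

text \<open>The lower bound by a multiple of \<open>sum w A\<close> is what makes the induction go through.\<close>

lemma sum_mult_antimono_lower_bound:
  fixes p w :: "'a::linorder \<Rightarrow> real"
  assumes "finite A"
    and "antimono_on A p"
    and "\<And>i. i \<in> A \<Longrightarrow> 0 \<le> (\<Sum>k | k \<in> A \<and> k \<le> i. w k)"
    and "0 \<le> c" "\<And>i. i \<in> A \<Longrightarrow> c \<le> p i"
  shows "c * sum w A \<le> (\<Sum>i\<in>A. p i * w i)"
  using assms
proof (induction A arbitrary: c rule: finite_linorder_max_induct)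
  case empty
  then show ?case by simp
next
  case (insert b A)
  have b: "b \<notin> A" using insert.hyps by auto
  \<comment> \<open>Since \<open>b\<close> lies above all of \<open>A\<close>, inserting it leaves
    the earlier initial segments unchanged, and its own segment is everything.\<close>
  have sets: "{k. k \<in> insert b A \<and> k \<le> i} = {k. k \<in> A \<and> k \<le> i}" if "i \<in> A" for i
    using insert.hyps that by force
  have "{k. k \<in> insert b A \<and> k \<le> b} = insert b A"
    using insert.hyps by force
  then have total: "0 \<le> sum w (insert b A)"
    using insert.prems(2)[of b] by simp
  \<comment> \<open>The induction hypothesis is taken at \<open>p b\<close> instead of
    \<open>c\<close>, so that adding the new term \<open>p b * w b\<close> completes a multiple of
    the full sum.\<close>
  have "p b * sum w A \<le> (\<Sum>i\<in>A. p i * w i)"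
  proof (rule insert.IH)
    show "antimono_on A p"
      using insert.prems(1) by (rule monotone_on_subset) auto
    show "0 \<le> (\<Sum>k | k \<in> A \<and> k \<le> i. w k)" if "i \<in> A" for i
      using insert.prems(2)[of i] that sets[OF that] by simp
    show "0 \<le> p b"
      using insert.prems(3,4) order_trans by blast
    show "p b \<le> p i" if "i \<in> A" for i
      using insert.prems(1) insert.hyps that
      by (auto simp: monotone_on_def less_imp_le)
  qed
  then have "p b * sum w (insert b A) \<le> (\<Sum>i\<in>insert b A. p i * w i)"
    using insert.hyps b by (simp add: distrib_left)
  \<comment> \<open>Lowering \<open>p b\<close> to \<open>c\<close> is safe because the total is
    nonnegative; \<open>w b\<close> itself may have either sign.\<close>
  moreover have "c * sum w (insert b A) \<le> p b * sum w (insert b A)"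
    using total insert.prems(4) by (intro mult_right_mono) auto
  ultimately show ?case by linarith
qed

text \<open>Chain rule on a line. General \<open>t\<close> serves the mean value argument; partial
  derivatives and difference quotients use \<open>t = 0\<close>.\<close>

lemma has_real_derivative_along_line:
  fixes f :: "'a::real_normed_vector \<Rightarrow> real"
  assumes "(f has_derivative D) (at (z + t *\<^sub>R w))"
  shows "((\<lambda>t. f (z + t *\<^sub>R w)) has_real_derivative D w) (at t)"
proof -
  have "((\<lambda>t. z + t *\<^sub>R w) has_derivative (\<lambda>h. h *\<^sub>R w)) (at t)"
    by (auto intro!: derivative_eq_intros)
  then have "((\<lambda>t. f (z + t *\<^sub>R w)) has_derivative (\<lambda>h. D (h *\<^sub>R w))) (at t)"
    using assms by (rule has_derivative_compose)
  moreover have "D (h *\<^sub>R w) = D w * h" for h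
    using linear_scale[OF has_derivative_linear[OF assms]] by simp
  ultimately show ?thesis
    by (simp add: has_field_derivative_def)
qed

lemma partial_deriv_eq:
  assumes "(f has_derivative D) (at z)"
  shows "partial_deriv i f z = D (axis i 1)"
  unfolding partial_deriv_def
  by (intro DERIV_imp_deriv has_real_derivative_along_line) (use assms in simp)

lemma has_derivative_eq_sum_partial_deriv:
  assumes "(f has_derivative D) (at z)"
  shows "D w = (\<Sum>i\<in>UNIV. partial_deriv i f z * w $ i)"
proof -
  have "linear D" using assms by (rule has_derivative_linear)
  then have "D w = (\<Sum>i\<in>UNIV. w $ i *\<^sub>R D (axis i 1))"
    by (subst basis_expansion[of w, symmetric])
      (simp add: linear_sum linear_scale scalar_mult_eq_scaleR)
  then show ?thesis
    by (simp add: partial_deriv_eq[OF assms] mult.commute)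
qed

lemma weak_majorized_add_scaleR:
  assumes "0 \<precsim> w" "0 \<le> t"
  shows "u \<precsim> u + t *\<^sub>R w"
  using assms by (simp add: weak_majorized_def sum.distrib flip: sum_distrib_left)

lemma weak_majorized_diff: "u \<precsim> v \<Longrightarrow> 0 \<precsim> v - u"
  by (simp add: weak_majorized_def sum_subtractf)

lemma zero_weak_majorized_axis: "0 \<precsim> axis i 1"
  by (auto simp: weak_majorized_def axis_def intro: sum_nonneg)

text \<open>The partial sum up to \<open>m\<close> is 1 if \<open>i \<le> m < j\<close> and 0
  otherwise.\<close>

lemma zero_weak_majorized_axis_diff:
  assumes "i \<le> j"
  shows "0 \<precsim> axis i 1 - axis j 1"
  using assms by (auto simp: weak_majorized_def axis_def sum_subtractf)

text \<open>If \<open>D w\<close> were negative, \<open>f\<close> would drop strictly just after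
  leaving \<open>z\<close> along \<open>w\<close>, although such a move goes up in the
  order.\<close>

lemma directional_deriv_nonneg:
  fixes f :: "real ^ 'n::{finite,linorder} \<Rightarrow> real"
  assumes mono: "\<And>u v. u \<precsim> v \<Longrightarrow> f u \<le> f v"
    and D: "(f has_derivative D) (at z)" and w: "0 \<precsim> w"
  shows "0 \<le> D w"
proof (rule ccontr)
  assume "\<not> 0 \<le> D w"
  moreover have "((\<lambda>t. f (z + t *\<^sub>R w)) has_real_derivative D w) (at 0)"
    using D by (intro has_real_derivative_along_line) simp
  ultimately obtain d where "0 < d" and
    d: "\<And>h. 0 < h \<Longrightarrow> h < d \<Longrightarrow> f (z + h *\<^sub>R w) < f z"
    using DERIV_neg_dec_right[of "\<lambda>t. f (z + t *\<^sub>R w)" "D w" 0] by auto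
  then show False
    using d[of "d / 2"] mono[OF weak_majorized_add_scaleR[OF w, of "d / 2" z]] by linarith
qed

theorem theorem6p1:
  fixes f :: "real ^ 'n::{finite,linorder} \<Rightarrow> real"
  assumes "continuously_differentiable f"
  shows "(\<forall>u v. u \<precsim> v \<longrightarrow> f u \<le> f v) \<longleftrightarrow>
    (\<forall>z. (\<forall>i j. i \<le> j \<longrightarrow> partial_deriv i f z \<ge> partial_deriv j f z) \<and>
         (\<forall>i. partial_deriv i f z \<ge> 0))"
proof -
  obtain D where D: "\<And>x. (f has_derivative blinfun_apply (D x)) (at x)"
    using assms unfolding continuously_differentiable_def by blast
  show ?thesis
  proof (intro iffI allI conjI impI)
    fix z and i j :: 'n
    assume mono: "\<forall>u v. u \<precsim> v \<longrightarrow> f u \<le> f v" and "i \<le> j"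
    then have "0 \<le> D z (axis i 1 - axis j 1)"
      using directional_deriv_nonneg[OF _ D zero_weak_majorized_axis_diff] by blast
    then show "partial_deriv j f z \<le> partial_deriv i f z"
      using linear_diff[OF has_derivative_linear[OF D]] by (simp add: partial_deriv_eq[OF D])
  next
    fix z and i :: 'n
    assume "\<forall>u v. u \<precsim> v \<longrightarrow> f u \<le> f v"
    then show "0 \<le> partial_deriv i f z"
      using directional_deriv_nonneg[OF _ D zero_weak_majorized_axis]
      by (simp add: partial_deriv_eq[OF D])
  next
    fix u v :: "(real, 'n) vec"
    assume partials: "\<forall>z. (\<forall>i j. i \<le> j \<longrightarrow> partial_deriv i f z \<ge> partial_deriv j f z) \<and>
         (\<forall>i. partial_deriv i f z \<ge> 0)"
      and "u \<precsim> v"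
    define w where "w = v - u"
    have w: "0 \<precsim> w"
      using \<open>u \<precsim> v\<close> by (simp add: w_def weak_majorized_diff)
    have "0 \<le> D z w" for z
    proof -
      \<comment> \<open>The bound \<open>c = 0\<close> is the nonnegativity of the partial
        derivatives.\<close>
      have "0 * sum (($) w) UNIV \<le> (\<Sum>i\<in>UNIV. partial_deriv i f z * w $ i)"
        by (rule sum_mult_antimono_lower_bound)
          (use partials w in \<open>auto simp: monotone_on_def weak_majorized_def atMost_def\<close>)
      then show ?thesis
        by (simp add: has_derivative_eq_sum_partial_deriv[OF D])
    qed
    \<comment> \<open>The derivative in direction \<open>w\<close> is nonnegative at every point, so
      \<open>f\<close> is nondecreasing along the segment from \<open>u\<close> to
      \<open>v\<close>.\<close>
    then have "f (u + 0 *\<^sub>R w) \<le> f (u + 1 *\<^sub>R w)"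
      by (intro DERIV_nonneg_imp_nondecreasing[where f = "\<lambda>t. f (u + t *\<^sub>R w)"])
        (auto intro!: exI has_real_derivative_along_line D)
    then show "f u \<le> f v"
      by (simp add: w_def)
  qed
qed

end
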